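(* Let $q$ be an odd prime power, $d\ge2$, $Q$ a nondegenerate quadratic form on $\mathbb F_q^d$. Let $P\subseteq\mathbb F_q^d$ be nonempty, let $\mathcal S$ be a nonempty family of distinct $Q$-spheres, and let $K>0$. Suppose $$\sigma(P,\mathcal S)\ge Kq^{(d-1)/2}\sqrt{|P||\mathcal S|}\qquad\text{and}\qquad K^2q^{d-1}|\mathcal S|\ge4|P|.$$ Then at least $K^2|\mathcal S|/4$ ordered pairs $(S,S')$ of distinct spheres in $\mathcal S$ satisfy $$|P\cap S\cap S'|\ge\frac{K^2q^{d-1}}{4|\mathcal S|}.\tag{*}$$ Every such pair supplies a radical hyperplane $H(S,S')$ with $|P\cap H(S,S')|$ at least the same number. At least $K^2/8$ spheres of $\mathcal S$ each have at least $K^2/8$ witnessing partners. If $d\ge3$, at least $K^2q|\mathcal S|/8$ ordered pairs satisfy ( * ), and at least $K^2q/16$ spheres each have at least $K^2q/16$ witnessing partners.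
   Context: Put $\langle x,y\rangle_Q=\frac{Q(x+y)-Q(x)-Q(y)}2$. For $c\in\mathbb F_q^d$, $r\in\mathbb F_q$ the $Q$-sphere is $S_Q(c,r)=\{x\in\mathbb F_q^d:Q(x-c)=r\}$; spheres are parametrized by pairs $(c,r)$ and distinct spheres means distinct parameter pairs. $\sigma(P,\mathcal S)=|\{(p,S)\in P\times\mathcal S:p\in S\}|-|P||\mathcal S|/q$. For spheres $S=S_Q(c,r)$, $S'=S_Q(c',r')$ with $c\ne c'$, the radical hyperplane is the affine hyperplane $$H(S,S')=\{x\in\mathbb F_q^d:2\langle c'-c,x\rangle_Q=(r-r')-Q(c)+Q(c')\},$$ which contains $S\cap S'$; two distinct spheres with the same center are disjoint, so every pair satisfying ( * ) has $c\neq c'$. A witnessing partner of $S\in\mathcal S$ is a sphere $S'\in\mathcal S$, $S'\ne S$, such that $(S,S')$ satisfies ( * ). *)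

theory Defs
  imports "HOL-Analysis.Analysis"
begin

text \<open>
  The field \<open>F_q\<close> is a type of sort \<open>{field, finite}\<close> with \<open>q = CARD('a)\<close>, and
  \<open>F_q^d\<close> is \<open>'a ^ 'n\<close> with \<open>d = CARD('n)\<close>. The division by \<open>2\<close> in \<open>qinner\<close>
  is meaningful only in odd characteristic, i.e. for odd \<open>CARD('a)\<close>; everything below
  is intended for that case.
\<close>

definition qinner :: "(('a::field) ^ 'n \<Rightarrow> 'a) \<Rightarrow> 'a ^ 'n \<Rightarrow> 'a ^ 'n \<Rightarrow> 'a" where
  "qinner Q x y = (Q (x + y) - Q x - Q y) / 2"

definition quadratic_form :: "(('a::field) ^ 'n \<Rightarrow> 'a) \<Rightarrow> bool" where
  "quadratic_form Q \<longleftrightarrow>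
     (\<forall>a x. Q (a *s x) = a\<^sup>2 * Q x) \<and>
     (\<forall>y. Vector_Spaces.linear (*s) (*) (\<lambda>x. qinner Q x y)) \<and>
     (\<forall>x. Vector_Spaces.linear (*s) (*) (\<lambda>y. qinner Q x y))"

definition nondegenerate :: "(('a::field) ^ 'n \<Rightarrow> 'a) \<Rightarrow> bool" where
  "nondegenerate Q \<longleftrightarrow> (\<forall>x. (\<forall>y. qinner Q x y = 0) \<longrightarrow> x = 0)"

text \<open>
  A sphere is represented by its parameter pair \<open>(c, r)\<close> (centre, value), so that a family of
  distinct spheres is a set of pairs; \<open>qsphere Q\<close> maps a pair to its point set. Different
  pairs may have the same point set (for instance the empty set).
\<close>

definition qsphere :: "(('a::field) ^ 'n \<Rightarrow> 'a) \<Rightarrow> ('a ^ 'n) \<times> 'a \<Rightarrow> ('a ^ 'n) set" where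
  "qsphere Q = (\<lambda>(c, r). {x. Q (x - c) = r})"

definition incidence_excess ::
  "(('a::{field,finite}) ^ 'n \<Rightarrow> 'a) \<Rightarrow> ('a ^ 'n) set \<Rightarrow> (('a ^ 'n) \<times> 'a) set \<Rightarrow> real" where
  "incidence_excess Q P \<S> =
     real (card {(p, S). p \<in> P \<and> S \<in> \<S> \<and> p \<in> qsphere Q S})
       - real (card P) * real (card \<S>) / real CARD('a)"

definition affine_hyperplane :: "(('a::field) ^ 'n) set \<Rightarrow> bool" where
  "affine_hyperplane H \<longleftrightarrow>
     (\<exists>f b. Vector_Spaces.linear (*s) (*) f \<and> (\<exists>x. f x \<noteq> 0) \<and> H = {x. f x = b})"

text \<open>
  For equal centres the following set is either empty or the whole space; it is a hyperplane
  only when the centres differ.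
\<close>

definition radical_hyperplane ::
  "(('a::field) ^ 'n \<Rightarrow> 'a) \<Rightarrow> ('a ^ 'n) \<times> 'a \<Rightarrow> ('a ^ 'n) \<times> 'a \<Rightarrow> ('a ^ 'n) set" where
  "radical_hyperplane Q = (\<lambda>(c, r) (c', r').
     {x. 2 * qinner Q (c' - c) x = (r - r') - Q c + Q c'})"

definition witnessing_pairs ::
  "(('a::{field,finite}) ^ 'n \<Rightarrow> 'a) \<Rightarrow> ('a ^ 'n) set \<Rightarrow> (('a ^ 'n) \<times> 'a) set \<Rightarrow> real \<Rightarrow>
     ((('a ^ 'n) \<times> 'a) \<times> (('a ^ 'n) \<times> 'a)) set" where
  "witnessing_pairs Q P \<S> K =
     {(S, S'). S \<in> \<S> \<and> S' \<in> \<S> \<and> S \<noteq> S' \<and>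
        real (card (P \<inter> qsphere Q S \<inter> qsphere Q S'))
          \<ge> K\<^sup>2 * real CARD('a) ^ (CARD('n) - 1) / (4 * real (card \<S>))}"

definition witnessing_partners ::
  "(('a::{field,finite}) ^ 'n \<Rightarrow> 'a) \<Rightarrow> ('a ^ 'n) set \<Rightarrow> (('a ^ 'n) \<times> 'a) set \<Rightarrow> real \<Rightarrow>
     ('a ^ 'n) \<times> 'a \<Rightarrow> (('a ^ 'n) \<times> 'a) set" where
  "witnessing_partners Q P \<S> K S = {S'. (S, S') \<in> witnessing_pairs Q P \<S> K}"

end

theory Submission
  imports Defs
begin

text \<open>
  By the Cauchy--Schwarz inequality the incidences \<open>I\<close> satisfy
  \<open>\<Sum>\<^bsub>(S, S')\<^esub> \<bar>P \<inter> S \<inter> S'\<bar> \<ge> I\<^sup>2 / \<bar>P\<bar>\<close>. The lower bound on the excess gives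
  \<open>I\<^sup>2 \<ge> K\<^sup>2 q\<^bsup>d-1\<^esup> \<bar>P\<bar> \<bar>\<S>\<bar>\<close>, and with the second hypothesis \<open>I \<ge> 2 \<bar>P\<bar>\<close>, so that the
  diagonal, which contributes \<open>I\<close>, is at most half of this. Pairs violating the lower bound on
  \<open>\<bar>P \<inter> S \<inter> S'\<bar>\<close> account for at most half of the rest, and every other pair contributes at most
  \<open>\<bar>S \<inter> S'\<bar>\<close>. This is at most \<open>q\<^bsup>d-1\<^esup>\<close>, as \<open>S \<inter> S'\<close> lies in a hyperplane, and at most
  \<open>2 q\<^bsup>d-2\<^esup>\<close> if \<open>d \<ge> 3\<close>, since a nondegenerate form does not vanish on a linear hyperplane.
\<close>

section \<open>Double counting and pigeonhole for finite set systems\<close>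

text \<open>Cauchy--Schwarz is applied over \<open>P\<close> to the number of sets
  \<open>X b\<close> through each point; the square of that number counts the ordered pairs of such
  sets.\<close>

lemma incidence_sum_squared_le:
  fixes X :: "'b \<Rightarrow> 'c set"
  assumes "finite P" "finite B"
  shows "(\<Sum>b\<in>B. real (card (P \<inter> X b)))\<^sup>2
    \<le> real (card P) * (\<Sum>(b, b')\<in>B \<times> B. real (card (P \<inter> X b \<inter> X b')))"
proof -
  have count: "real (card (P \<inter> Y)) = (\<Sum>p\<in>P. of_bool (p \<in> Y))" for Y
    using assms by (simp add: of_bool_def sum.If_cases Int_def)
  have "(\<Sum>b\<in>B. real (card (P \<inter> X b))) = (\<Sum>p\<in>P. \<Sum>b\<in>B. of_bool (p \<in> X b))"
    unfolding count by (rule sum.swap)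
  also have "\<dots>\<^sup>2 \<le> real (card P) * (\<Sum>p\<in>P. (\<Sum>b\<in>B. of_bool (p \<in> X b))\<^sup>2)"
    using Cauchy_Schwarz_ineq_sum[of "\<lambda>_. 1" "\<lambda>p. \<Sum>b\<in>B. of_bool (p \<in> X b) :: real" P] by simp
  also have "(\<Sum>p\<in>P. (\<Sum>b\<in>B. of_bool (p \<in> X b))\<^sup>2)
      = (\<Sum>p\<in>P. \<Sum>(b, b')\<in>B \<times> B. of_bool (p \<in> X b \<inter> X b') :: real)"
    by (simp add: power2_eq_square sum_product sum.cartesian_product of_bool_conj)
  also have "\<dots> = (\<Sum>(b, b')\<in>B \<times> B. real (card (P \<inter> X b \<inter> X b')))"
    unfolding Int_assoc count by (subst sum.swap) (simp add: case_prod_unfold)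
  finally show ?thesis .
qed

text \<open>Stated for abstract sets and any bound \<open>M\<close> on pairwise intersections, so
  that it serves both the bound for all dimensions and the sharper one for dimension at least
  3.\<close>

lemma card_popular_pairs_ge:
  fixes X :: "'b \<Rightarrow> 'c set" and L M :: real
  assumes "finite P" "finite B" "B \<noteq> {}" "P \<noteq> {}" "L \<ge> 0"
    and I_def: "I = (\<Sum>b\<in>B. real (card (P \<inter> X b)))"
    and I_ge: "I \<ge> 2 * real (card P)"
    and I_sq: "I\<^sup>2 \<ge> L * real (card P) * real (card B)"
    and M: "\<And>b b'. b \<in> B \<Longrightarrow> b' \<in> B \<Longrightarrow> b \<noteq> b' \<Longrightarrow> real (card (P \<inter> X b \<inter> X b')) \<le> M"
  shows "L * real (card B) / 4
    \<le> M * real (card {(b, b'). b \<in> B \<and> b' \<in> B \<and> b \<noteq> b' \<and>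
                        real (card (P \<inter> X b \<inter> X b')) \<ge> L / (4 * real (card B))})"
proof -
  define n s where "n = real (card P)" and "s = real (card B)"
  define g where "g = (\<lambda>(b, b'). real (card (P \<inter> X b \<inter> X b')))"
  define D where "D = {z \<in> B \<times> B. fst z \<noteq> snd z}"
  define W where "W = {z \<in> D. g z \<ge> L / (4 * s)}"
  have n: "n > 0" and s: "s > 0" using assms by (auto simp: n_def s_def card_gt_0_iff)
  have fin: "finite (B \<times> B)" "finite D" "finite W" using assms by (auto simp: D_def W_def)
  have diag: "sum g (B \<times> B - D) = I"
  proof -
    have "B \<times> B - D = (\<lambda>b. (b, b)) ` B" by (auto simp: D_def)
    then have "sum g (B \<times> B - D) = (\<Sum>b\<in>B. g (b, b))"
      by (simp add: sum.reindex inj_on_def)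
    then show ?thesis by (simp add: I_def g_def Int_assoc)
  qed
  have "I\<^sup>2 \<le> n * sum g (B \<times> B)"
    using incidence_sum_squared_le[of P B X] assms unfolding I_def n_def g_def by simp
  also have "sum g (B \<times> B) = sum g D + I"
    using sum.subset_diff[of D "B \<times> B" g] fin diag by (auto simp: D_def)
  finally have "I\<^sup>2 \<le> n * sum g D + n * I" by (simp add: algebra_simps)
  moreover have "2 * n * I \<le> I * I"
    using I_ge n by (intro mult_right_mono) (auto simp: n_def)
  \<comment> \<open>The diagonal term \<open>n * I\<close> is at most half of
    \<open>I\<^sup>2\<close>, so \<open>I\<^sup>2\<close> is at most
    \<open>2 * n * sum g D\<close>.\<close>
  ultimately have "n * (L * s) \<le> n * (2 * sum g D)"
    using I_sq by (simp add: power2_eq_square n_def s_def algebra_simps)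
  then have "L * s / 2 \<le> sum g D" using n by simp
  also have "sum g D = sum g W + sum g (D - W)"
    using sum.subset_diff[of W D g] fin by (simp add: W_def)
  also have "sum g (D - W) \<le> real (card (D - W)) * (L / (4 * s))"
    by (rule sum_bounded_above) (auto simp: W_def)
  \<comment> \<open>There are at most \<open>s\<^sup>2\<close> unpopular pairs; the threshold
    \<open>L / (4 * s)\<close> makes their total at most \<open>L * s / 4\<close>, half of the
    available mass.\<close>
  also have "\<dots> \<le> s\<^sup>2 * (L / (4 * s))"
  proof (rule mult_right_mono)
    have "card (D - W) \<le> card (B \<times> B)" using fin by (intro card_mono) (auto simp: D_def)
    then show "real (card (D - W)) \<le> s\<^sup>2"
      unfolding s_def card_cartesian_product power2_eq_square of_nat_mult[symmetric] of_nat_le_iff .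
    show "0 \<le> L / (4 * s)" using \<open>L \<ge> 0\<close> s by simp
  qed
  also have "\<dots> = L * s / 4" using s by (simp add: power2_eq_square)
  also have "sum g W \<le> real (card W) * M"
    by (rule sum_bounded_above) (use M in \<open>auto simp: W_def D_def g_def\<close>)
  finally have "L * s / 4 \<le> M * real (card W)" by (simp add: mult.commute)
  moreover have "W = {(b, b'). b \<in> B \<and> b' \<in> B \<and> b \<noteq> b' \<and>
      real (card (P \<inter> X b \<inter> X b')) \<ge> L / (4 * real (card B))}"
    by (auto simp: W_def D_def g_def s_def)
  ultimately show ?thesis by (simp add: s_def)
qed

text \<open>Elements with fewer than \<open>a / 2\<close> partners account for at most half of the
  guaranteed pairs. The other half comes from rich elements, each having at most
  \<open>card B\<close> partners.\<close>

lemma card_rich_ge: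
  fixes a :: real
  assumes "finite B" "B \<noteq> {}" "W \<subseteq> B \<times> B" "a \<ge> 0"
    and W: "real (card W) \<ge> a * real (card B)"
  shows "real (card {b \<in> B. real (card {b'. (b, b') \<in> W}) \<ge> a / 2}) \<ge> a / 2"
proof -
  define s where "s = real (card B)"
  define h where "h b = real (card {b'. (b, b') \<in> W})" for b
  define R where "R = {b \<in> B. h b \<ge> a / 2}"
  have s: "s > 0" using assms by (auto simp: s_def card_gt_0_iff)
  have "W = (SIGMA b:B. {b'. (b, b') \<in> W})" using assms by auto
  moreover have "finite {b'. (b, b') \<in> W}" for b
    by (rule finite_subset[OF _ \<open>finite B\<close>]) (use assms in auto)
  ultimately have "card W = (\<Sum>b\<in>B. card {b'. (b, b') \<in> W})"
    using card_SigmaI[of B "\<lambda>b. {b'. (b, b') \<in> W}"] \<open>finite B\<close> by simp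
  then have "a * s \<le> sum h B" using W by (simp add: h_def s_def)
  also have "sum h B = sum h R + sum h (B - R)"
    using sum.subset_diff[of R B h] \<open>finite B\<close> by (simp add: R_def)
  also have "sum h R \<le> real (card R) * s"
  proof (rule sum_bounded_above)
    fix b
    show "h b \<le> s" unfolding h_def s_def of_nat_le_iff
      by (rule card_mono[OF \<open>finite B\<close>]) (use assms in auto)
  qed
  also have "sum h (B - R) \<le> real (card (B - R)) * (a / 2)"
    by (rule sum_bounded_above) (auto simp: R_def)
  also have "\<dots> \<le> s * (a / 2)"
    using \<open>a \<ge> 0\<close> \<open>finite B\<close> by (intro mult_right_mono) (auto simp: s_def intro: card_mono)
  finally have "(a / 2) * s \<le> real (card R) * s" by (simp add: algebra_simps)
  then show ?thesis using s by (simp add: R_def h_def)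
qed

section \<open>Finite fields, linear functionals and hyperplanes\<close>

text \<open>Translation by 1 permutes the field and so preserves the sum of all elements, which
  forces the field's cardinality to be 0 in the field.\<close>

lemma two_neq_zero_if_odd_card:
  assumes "odd CARD('a::{field,finite})"
  shows "(2::'a) \<noteq> 0"
proof
  assume two: "(2::'a) = 0"
  have "(\<Sum>x\<in>UNIV. x + 1 :: 'a) = (\<Sum>x\<in>UNIV. x)"
    by (rule sum.reindex_bij_witness[of _ "\<lambda>x. x - 1" "\<lambda>x. x + 1"]) auto
  then have "of_nat CARD('a) = (0::'a)" by (simp add: sum.distrib)
  moreover obtain k where "CARD('a) = 2 * k + 1" using assms by (elim oddE)
  ultimately show False using two by simp
qed

lemma linear_functional_simps:
  fixes f :: "'a::field ^ 'n \<Rightarrow> 'a"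
  assumes "Vector_Spaces.linear (*s) (*) f"
  shows "f (x + y) = f x + f y" "f (x - y) = f x - f y" "f (a *s x) = a * f x"
proof -
  interpret Vector_Spaces.linear "(*s)" "(*)" f by fact
  show "f (x + y) = f x + f y" "f (x - y) = f x - f y" "f (a *s x) = a * f x"
    by (simp_all add: add diff scale)
qed

lemma linear_functional_eq_1:
  fixes f :: "'a::field ^ 'n \<Rightarrow> 'a"
  assumes "Vector_Spaces.linear (*s) (*) f" "f x \<noteq> 0"
  obtains e where "f e = 1"
  using that[of "inverse (f x) *s x"] assms by (simp add: linear_functional_simps(3)[OF assms(1)])

text \<open>The translates of \<open>H\<close> by multiples of a vector \<open>e\<close> with
  \<open>f e = 1\<close> are disjoint, since \<open>f\<close> recovers the multiple; hence one copy
  of \<open>H\<close> per scalar fits into the space.\<close>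

lemma card_affine_hyperplane_le:
  fixes H :: "('a::{field,finite} ^ 'n) set"
  assumes "affine_hyperplane H"
  shows "card H \<le> CARD('a) ^ (CARD('n) - 1)"
proof -
  obtain f b z where f: "Vector_Spaces.linear (*s) (*) f" and "f z \<noteq> 0" and H: "H = {x. f x = b}"
    using assms by (auto simp: affine_hyperplane_def)
  then obtain e where e: "f e = 1" using linear_functional_eq_1 by metis
  have inj: "inj_on (\<lambda>(x, t). x + t *s e) (H \<times> UNIV)"
    by (rule inj_on_inverseI[where g = "\<lambda>y. (y - (f y - b) *s e, f y - b)"])
       (auto simp: H linear_functional_simps[OF f] e)
  have "card H * CARD('a) \<le> CARD('a) ^ CARD('n)"
    using card_inj_on_le[OF inj, of UNIV] by (simp add: card_cartesian_product)
  also have "\<dots> = CARD('a) ^ (CARD('n) - 1) * CARD('a)"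
    by (rule power_minus_mult[symmetric]) simp
  finally show ?thesis by (rule mult_right_le_imp_le) simp
qed

lemma card_quadratic_roots_le:
  fixes a b c :: "'a::field"
  assumes "a \<noteq> 0"
  shows "card {t. a * t\<^sup>2 + b * t + c = 0} \<le> 2"
proof -
  have eq: "{t. a * t\<^sup>2 + b * t + c = 0} = {t. poly [:c, b, a:] t = 0}"
    by (auto simp: power2_eq_square algebra_simps)
  have nz: "[:c, b, a:] \<noteq> 0" using assms by simp
  show "card {t. a * t\<^sup>2 + b * t + c = 0} \<le> 2"
    unfolding eq using card_poly_roots_bound[OF nz] assms by simp
qed

section \<open>Polarization and radical hyperplanes\<close>

context
  fixes Q :: "'a::field ^ 'n \<Rightarrow> 'a"
  assumes Q: "quadratic_form Q" and two: "(2::'a) \<noteq> 0"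
begin

lemma linear_qinner: "Vector_Spaces.linear (*s) (*) (qinner Q x)"
  using Q by (simp add: quadratic_form_def)

lemmas qinner_simps = linear_functional_simps[OF linear_qinner]

lemma qinner_commute: "qinner Q x y = qinner Q y x"
  by (simp add: qinner_def add.commute algebra_simps)

lemma quadratic_form_scale: "Q (a *s x) = a\<^sup>2 * Q x"
  using Q by (simp add: quadratic_form_def)

lemma quadratic_form_add: "Q (x + y) = Q x + Q y + 2 * qinner Q x y"
  using two unfolding qinner_def times_divide_eq_right by (simp add: field_simps)

lemma quadratic_form_diff: "Q (x - y) = Q x + Q y - 2 * qinner Q x y"
proof -
  have "x - y = x + (- 1) *s y" by (simp add: vector_sneg_minus1[symmetric])
  then show ?thesis
    by (simp only: quadratic_form_add quadratic_form_scale qinner_simps) simp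
qed

text \<open>Subtracting the two sphere equations cancels \<open>Q x\<close> and leaves a linear
  equation.\<close>

lemma Int_qsphere_subset_radical_hyperplane:
  "qsphere Q S \<inter> qsphere Q S' \<subseteq> radical_hyperplane Q S S'"
proof -
  obtain c r c' r' where S: "S = (c, r)" "S' = (c', r')" by fastforce
  have "2 * qinner Q (c' - c) x = Q (x - c) - Q (x - c') - Q c + Q c'" for x
    by (simp add: quadratic_form_diff qinner_commute[of "c' - c"] qinner_simps algebra_simps)
  then show ?thesis by (auto simp: S qsphere_def radical_hyperplane_def)
qed

lemma affine_hyperplane_radical_hyperplane:
  assumes "nondegenerate Q" "fst S \<noteq> fst S'"
  shows "affine_hyperplane (radical_hyperplane Q S S')"
proof -
  obtain c r c' r' where S: "S = (c, r)" "S' = (c', r')" by fastforce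
  obtain x where "qinner Q (c' - c) x \<noteq> 0"
    using assms unfolding nondegenerate_def S by force
  moreover have "radical_hyperplane Q S S' = {x. qinner Q (c' - c) x = (r - r' - Q c + Q c') / 2}"
    using two by (auto simp: S radical_hyperplane_def field_simps)
  ultimately show ?thesis
    unfolding affine_hyperplane_def using linear_qinner by blast
qed

end

lemma Int_qsphere_same_center:
  assumes "S \<noteq> S'" "fst S = fst S'"
  shows "qsphere Q S \<inter> qsphere Q S' = {}"
  using assms by (cases S; cases S') (auto simp: qsphere_def)

section \<open>Intersections of two spheres in dimension at least 3\<close>

text \<open>If \<open>Q\<close> vanished on the orthogonal complement of \<open>w\<close>, so would
  its polarization. A nonzero vector of that complement that is also orthogonal to some
  \<open>u\<close> outside it would then be orthogonal to everything.\<close>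

lemma exists_nonisotropic_orthogonal:
  fixes Q :: "'a::{field,finite} ^ 'n \<Rightarrow> 'a"
  assumes Q: "quadratic_form Q" and two: "(2::'a) \<noteq> 0" and nd: "nondegenerate Q"
    and "w \<noteq> 0" and d: "CARD('n) \<ge> 3"
  obtains v where "qinner Q w v = 0" "Q v \<noteq> 0"
proof -
  note simps = qinner_simps[OF Q two]
  have "\<exists>v. qinner Q w v = 0 \<and> Q v \<noteq> 0"
  proof (rule ccontr)
    assume "\<not> ?thesis"
    then have iso: "Q v = 0" if "qinner Q w v = 0" for v using that by blast
    obtain z where "qinner Q w z \<noteq> 0"
      using nd \<open>w \<noteq> 0\<close> unfolding nondegenerate_def by blast
    then obtain u where u: "qinner Q w u = 1"
      using linear_functional_eq_1[OF linear_qinner[OF Q two]] by metis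
    \<comment> \<open>By counting, two functionals cannot separate points in dimension at least 3;
      the difference of two colliding points is a nonzero vector in both kernels.\<close>
    have "\<not> inj (\<lambda>x. (qinner Q w x, qinner Q u x))"
    proof
      assume "inj (\<lambda>x. (qinner Q w x, qinner Q u x))"
      then have "CARD('a ^ 'n) \<le> CARD('a \<times> 'a)"
        by (rule card_inj_on_le) auto
      moreover have "card {0, 1 :: 'a} \<le> CARD('a)" by (rule card_mono) auto
      then have "CARD('a) ^ 2 < CARD('a) ^ CARD('n)"
        using d by (intro power_strict_increasing) auto
      ultimately show False by (simp add: power2_eq_square)
    qed
    then obtain x y where "x \<noteq> y" "qinner Q w x = qinner Q w y" "qinner Q u x = qinner Q u y"
      by (auto simp: inj_def)
    then have z: "x - y \<noteq> 0" "qinner Q w (x - y) = 0" "qinner Q u (x - y) = 0"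
      by (auto simp: simps)
    have "qinner Q (x - y) p = 0" for p
    proof -
      \<comment> \<open>Removing the \<open>u\<close>-component puts \<open>p'\<close> in the
        complement of \<open>w\<close>; then \<open>x - y\<close>, \<open>p'\<close> and their sum
        are all isotropic.\<close>
      define p' where "p' = p - qinner Q w p *s u"
      have "qinner Q w p' = 0" by (simp add: p'_def simps u)
      then have "qinner Q (x - y) p' = 0"
        using z iso by (simp add: qinner_def[of Q "x - y"] simps)
      then show ?thesis using z by (simp add: p'_def simps qinner_commute[OF Q two, of _ u])
    qed
    then show False using nd z unfolding nondegenerate_def by blast
  qed
  then show ?thesis using that by blast
qed

text \<open>
  The set is swept by translations along two directions, one transversal to the hyperplane and
  one non-isotropic inside it: a point of the space is reached at most twice, as the first
  coordinate is determined and the second is a root of a quadratic polynomial.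
\<close>

lemma card_Int_qsphere_le:
  fixes Q :: "'a::{field,finite} ^ 'n \<Rightarrow> 'a"
  assumes Q: "quadratic_form Q" and two: "(2::'a) \<noteq> 0" and nd: "nondegenerate Q"
    and ne: "fst S \<noteq> fst S'" and d: "CARD('n) \<ge> 3"
  shows "card (qsphere Q S \<inter> qsphere Q S') \<le> 2 * CARD('a) ^ (CARD('n) - 2)"
proof -
  note simps = qinner_simps[OF Q two]
  obtain c r c' r' where S: "S = (c, r)" "S' = (c', r')" by fastforce
  define X where "X = qsphere Q S \<inter> qsphere Q S'"
  define w where "w = c' - c"
  define b where "b = (r - r' - Q c + Q c') / 2"
  have w: "w \<noteq> 0" using ne by (simp add: w_def S)
  obtain v where v: "qinner Q w v = 0" "Q v \<noteq> 0"
    using exists_nonisotropic_orthogonal[OF Q two nd w d] by blast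
  obtain z where "qinner Q w z \<noteq> 0" using nd w unfolding nondegenerate_def by blast
  then obtain e where e: "qinner Q w e = 1"
    using linear_functional_eq_1[OF linear_qinner[OF Q two]] by metis
  have Xb: "qinner Q w x = b" if "x \<in> X" for x
    using that Int_qsphere_subset_radical_hyperplane[OF Q two, of S S'] two
    by (auto simp: X_def S radical_hyperplane_def w_def b_def field_simps)
  have Xr: "Q (x - c) = r" if "x \<in> X" for x
    using that by (simp add: X_def S qsphere_def)
  define F where "F = (\<lambda>(x, s, t). x + s *s e + t *s v)"
  define Z where "Z = X \<times> (UNIV :: ('a \<times> 'a) set)"
  have fib: "card {z \<in> Z. F z = y} \<le> 2" for y
  proof -
    \<comment> \<open>As \<open>v\<close> is orthogonal to \<open>w\<close>, the value of
      \<open>qinner Q w\<close> at \<open>F (x, s, t)\<close> is \<open>b + s\<close>, so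
      \<open>y\<close> determines \<open>s\<close>.\<close>
    define s where "s = qinner Q w y - b"
    define y' where "y' = y - s *s e - c"
    \<comment> \<open>The equation is \<open>Q (y' - t *s v) = r\<close>, expanded in
      \<open>t\<close>; its leading coefficient \<open>Q v\<close> is nonzero.\<close>
    define T where "T = {t. Q v * t\<^sup>2 + (- 2 * qinner Q y' v) * t + (Q y' - r) = 0}"
    have "{z \<in> Z. F z = y} \<subseteq> (\<lambda>t. (y - s *s e - t *s v, s, t)) ` T"
    proof
      fix z assume "z \<in> {z \<in> Z. F z = y}"
      then obtain x s' t where z: "z = (x, s', t)" "x \<in> X" "y = x + s' *s e + t *s v"
        by (auto simp: Z_def F_def)
      then have s: "s' = s" by (simp add: s_def simps Xb v e)
      have x: "x = y - s *s e - t *s v" using z s by simp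
      have "Q (y' - t *s v) = r"
        using Xr[OF z(2)] x by (simp add: y'_def algebra_simps)
      then have "t \<in> T"
        by (simp add: T_def quadratic_form_diff[OF Q two] quadratic_form_scale[OF Q two] simps
              algebra_simps)
      then show "z \<in> (\<lambda>t. (y - s *s e - t *s v, s, t)) ` T"
        unfolding z(1) s by (subst x) (rule imageI)
    qed
    then have "card {z \<in> Z. F z = y} \<le> card T" by (rule surj_card_le[rotated]) simp
    also have "card T \<le> 2" unfolding T_def by (rule card_quadratic_roots_le[OF v(2)])
    finally show ?thesis .
  qed
  have "card Z = (\<Sum>y\<in>UNIV. card {z \<in> Z. F z = y})"
    using sum.group[of Z UNIV F "\<lambda>_. 1::nat"] by simp
  also have "\<dots> \<le> CARD('a ^ 'n) * 2"
    using sum_bounded_above[of UNIV "\<lambda>y. card {z \<in> Z. F z = y}" 2] fib by simp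
  finally have "card X * CARD('a) ^ 2 \<le> 2 * CARD('a) ^ CARD('n)"
    by (simp add: Z_def card_cartesian_product power2_eq_square)
  also have "CARD('a) ^ CARD('n) = CARD('a) ^ (CARD('n) - 2) * CARD('a) ^ 2"
    using d by (simp only: le_add_diff_inverse2 flip: power_add)
  finally have "card X * CARD('a) ^ 2 \<le> (2 * CARD('a) ^ (CARD('n) - 2)) * CARD('a) ^ 2"
    by simp
  then show ?thesis unfolding X_def by (rule mult_right_le_imp_le) simp
qed

section \<open>Application to incidences of points and spheres\<close>

theorem corollary3p2:
  fixes Q :: "('a::{field,finite}) ^ 'n \<Rightarrow> 'a"
    and P :: "('a ^ 'n) set"
    and \<S> :: "(('a ^ 'n) \<times> 'a) set"
    and K :: real
    and q d :: nat
  assumes q_def: "q = CARD('a)" and "odd q"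
    and d_def: "d = CARD('n)" and "d \<ge> 2"
    and "quadratic_form Q" and "nondegenerate Q"
    and "P \<noteq> {}" and "\<S> \<noteq> {}" and "K > 0"
    and "incidence_excess Q P \<S>
           \<ge> K * real q powr ((real d - 1) / 2) * sqrt (real (card P) * real (card \<S>))"
    and "K\<^sup>2 * real q ^ (d - 1) * real (card \<S>) \<ge> 4 * real (card P)"
  shows "real (card (witnessing_pairs Q P \<S> K)) \<ge> K\<^sup>2 * real (card \<S>) / 4
    \<and> (\<forall>(S, S') \<in> witnessing_pairs Q P \<S> K.
         fst S \<noteq> fst S' \<and> affine_hyperplane (radical_hyperplane Q S S') \<and>
         real (card (P \<inter> radical_hyperplane Q S S'))
           \<ge> K\<^sup>2 * real q ^ (d - 1) / (4 * real (card \<S>)))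
    \<and> real (card {S \<in> \<S>. real (card (witnessing_partners Q P \<S> K S)) \<ge> K\<^sup>2 / 8}) \<ge> K\<^sup>2 / 8
    \<and> (d \<ge> 3 \<longrightarrow>
         real (card (witnessing_pairs Q P \<S> K)) \<ge> K\<^sup>2 * real q * real (card \<S>) / 8 \<and>
         real (card {S \<in> \<S>. real (card (witnessing_partners Q P \<S> K S)) \<ge> K\<^sup>2 * real q / 16})
           \<ge> K\<^sup>2 * real q / 16)"
proof -
  define X where "X = qsphere Q"
  define W where "W = witnessing_pairs Q P \<S> K"
  define n s where "n = real (card P)" and "s = real (card \<S>)"
  define L where "L = K\<^sup>2 * real q ^ (d - 1)"
  define I where "I = (\<Sum>S\<in>\<S>. real (card (P \<inter> X S)))"
  have q: "q > 0" by (simp add: q_def)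
  have two: "(2::'a) \<noteq> 0" using two_neq_zero_if_odd_card \<open>odd q\<close> by (simp add: q_def)
  note Q = \<open>quadratic_form Q\<close> and nd = \<open>nondegenerate Q\<close>
  have n: "n > 0" and s: "s > 0" using assms by (auto simp: n_def s_def card_gt_0_iff)
  have L: "L > 0" using \<open>K > 0\<close> q by (simp add: L_def)
  have W_eq: "W = {(S, S'). S \<in> \<S> \<and> S' \<in> \<S> \<and> S \<noteq> S' \<and>
      real (card (P \<inter> X S \<inter> X S')) \<ge> L / (4 * real (card \<S>))}"
    by (simp add: W_def X_def witnessing_pairs_def L_def q_def d_def)
  have "{(p, S). p \<in> P \<and> S \<in> \<S> \<and> p \<in> X S} = prod.swap ` (SIGMA S:\<S>. P \<inter> X S)"
    by auto
  then have "real (card {(p, S). p \<in> P \<and> S \<in> \<S> \<and> p \<in> X S}) = I"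
    by (simp add: card_image I_def)
  then have excess: "incidence_excess Q P \<S> = I - n * s / real q"
    by (simp add: incidence_excess_def X_def n_def s_def q_def)
  have "(K * real q powr ((real d - 1) / 2) * sqrt (n * s))\<^sup>2 = L * n * s"
  proof -
    have "(real q powr ((real d - 1) / 2))\<^sup>2 = real q powr (real (d - 1))"
      using \<open>d \<ge> 2\<close> by (simp add: power2_eq_square flip: powr_add)
    then show ?thesis
      using q n s by (simp add: power_mult_distrib L_def powr_realpow)
  qed
  \<comment> \<open>The expected count \<open>n * s / q\<close> is nonnegative, so the excess is a
    lower bound for \<open>I\<close> itself.\<close>
  moreover have "K * real q powr ((real d - 1) / 2) * sqrt (n * s) \<le> I"
  proof -
    have "0 \<le> n * s / real q" using n s q by simp
    then show ?thesis using assms(10) excess unfolding n_def s_def by linarith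
  qed
  moreover have "0 \<le> K * real q powr ((real d - 1) / 2) * sqrt (n * s)"
    using \<open>K > 0\<close> n s by simp
  ultimately have I_sq: "L * n * s \<le> I\<^sup>2" and I0: "I \<ge> 0"
    using power_mono[of "K * real q powr ((real d - 1) / 2) * sqrt (n * s)" I 2] by auto
  \<comment> \<open>The second hypothesis, \<open>4 * n \<le> L * s\<close>, enters here to make the
    diagonal small.\<close>
  have "(2 * n)\<^sup>2 = n * (4 * n)" by (simp add: power2_eq_square)
  also have "\<dots> \<le> n * (L * s)"
    using assms(11) n by (intro mult_left_mono) (auto simp: L_def n_def s_def)
  also have "\<dots> \<le> I\<^sup>2" using I_sq by (simp add: mult_ac)
  finally have I_ge: "2 * n \<le> I" using I0 by (rule power2_le_imp_le)
  \<comment> \<open>Concentric distinct spheres are disjoint, so \<open>M\<close> need only bound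
    intersections for distinct centres.\<close>
  have W_bound: "L * s / 4 \<le> M * real (card W)"
    if M: "\<And>S S'. fst S \<noteq> fst S' \<Longrightarrow> real (card (X S \<inter> X S')) \<le> M" and "M \<ge> 0" for M
  proof -
    have "real (card (P \<inter> X S \<inter> X S')) \<le> M" if "S \<noteq> S'" for S S'
    proof (cases "fst S = fst S'")
      case True
      then have "X S \<inter> X S' = {}" using Int_qsphere_same_center that by (simp add: X_def)
      then show ?thesis using \<open>M \<ge> 0\<close> by (simp add: Int_assoc)
    next
      case False
      have "card (P \<inter> X S \<inter> X S') \<le> card (X S \<inter> X S')" by (rule card_mono) auto
      then show ?thesis using M[OF False] by linarith
    qed
    then show ?thesis
      unfolding W_eq s_def
      using card_popular_pairs_ge[OF _ _ \<open>\<S> \<noteq> {}\<close> \<open>P \<noteq> {}\<close> _ I_def, of L M] L I_ge I_sq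
      by (simp add: n_def s_def)
  qed
  have radical: "fst S \<noteq> fst S' \<and> affine_hyperplane (radical_hyperplane Q S S') \<and>
      real (card (P \<inter> radical_hyperplane Q S S')) \<ge> L / (4 * s)" if "(S, S') \<in> W" for S S'
  proof -
    have SW: "S \<noteq> S'" "real (card (P \<inter> X S \<inter> X S')) \<ge> L / (4 * s)"
      using that by (auto simp: W_eq s_def)
    \<comment> \<open>Strict positivity of the threshold forces a common point, which rules out
      equal centres.\<close>
    moreover have "L / (4 * s) > 0" using L s by simp
    ultimately have "P \<inter> (X S \<inter> X S') \<noteq> {}" by (auto simp: Int_assoc)
    then have ne: "fst S \<noteq> fst S'"
      using Int_qsphere_same_center[OF SW(1), of Q] by (auto simp: X_def)
    have "card (P \<inter> X S \<inter> X S') \<le> card (P \<inter> radical_hyperplane Q S S')"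
      using Int_qsphere_subset_radical_hyperplane[OF Q two, of S S']
      by (intro card_mono) (auto simp: X_def)
    then show ?thesis
      using ne affine_hyperplane_radical_hyperplane[OF Q two nd ne] SW by linarith
  qed
  have plane: "real (card (X S \<inter> X S')) \<le> real q ^ (d - 1)" if "fst S \<noteq> fst S'" for S S'
  proof -
    have "card (X S \<inter> X S') \<le> card (radical_hyperplane Q S S')"
      unfolding X_def
      by (intro card_mono Int_qsphere_subset_radical_hyperplane[OF Q two]) simp
    also have "\<dots> \<le> q ^ (d - 1)"
      unfolding q_def d_def
      by (intro card_affine_hyperplane_le affine_hyperplane_radical_hyperplane[OF Q two nd that])
    finally show ?thesis by (simp flip: of_nat_power)
  qed
  have pairs: "K\<^sup>2 / 4 * s \<le> real (card W)"
  proof -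
    have "real q ^ (d - 1) * (K\<^sup>2 / 4 * s) \<le> real q ^ (d - 1) * real (card W)"
      using W_bound[OF plane] by (simp add: L_def mult_ac)
    then show ?thesis using q by simp
  qed
  have pairs3: "K\<^sup>2 * real q / 8 * s \<le> real (card W)" if "d \<ge> 3"
  proof -
    have "real (card (X S \<inter> X S')) \<le> 2 * real q ^ (d - 2)" if "fst S \<noteq> fst S'" for S S'
    proof -
      have "card (X S \<inter> X S') \<le> 2 * q ^ (d - 2)"
        using card_Int_qsphere_le[OF Q two nd that] \<open>d \<ge> 3\<close> by (simp add: X_def q_def d_def)
      then have "real (card (X S \<inter> X S')) \<le> real (2 * q ^ (d - 2))" by (simp only: of_nat_le_iff)
      then show ?thesis by simp
    qed
    \<comment> \<open>Compared with \<open>q ^ (d - 1)\<close>, the bound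
      \<open>2 * q ^ (d - 2)\<close> gains a factor \<open>q / 2\<close>, turning
      \<open>K\<^sup>2 / 4\<close> into \<open>K\<^sup>2 * q / 8\<close>.\<close>
    then have "L * s / 4 \<le> 2 * real q ^ (d - 2) * real (card W)" by (intro W_bound) simp_all
    moreover have "L = K\<^sup>2 * (real q ^ (d - 2) * real q)"
    proof -
      have "d - 1 = Suc (d - 2)" using that by simp
      then show ?thesis by (simp only: L_def power_Suc2)
    qed
    ultimately have "real q ^ (d - 2) * (K\<^sup>2 * real q / 8 * s) \<le> real q ^ (d - 2) * real (card W)"
      by (simp add: mult_ac)
    then show ?thesis using q by simp
  qed
  have WB: "W \<subseteq> \<S> \<times> \<S>" by (auto simp: W_eq)
  have rich: "real (card {S \<in> \<S>. real (card (witnessing_partners Q P \<S> K S)) \<ge> a / 2}) \<ge> a / 2"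
    if "a * s \<le> real (card W)" "a \<ge> 0" for a
    using card_rich_ge[OF _ \<open>\<S> \<noteq> {}\<close> WB, of a] that
    by (simp add: s_def witnessing_partners_def W_def)
  show ?thesis
    using pairs pairs3 radical rich[OF pairs] rich[OF pairs3]
    by (auto simp: W_def s_def L_def)
qed

end
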